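(* Let $\mathcal G=(\mathcal V,\mathcal E)$ be a finite directed graph with more than two nodes and with a self-loop $(i,i)\in\mathcal E$ at every node, let $W\in\mathbb R^{\mathcal V\times\mathcal V}$ be a nonnegative row-stochastic matrix with $W_{ij}=0$ whenever $(i,j)\notin\mathcal E$, let $\Lambda=I-\mathrm{diag}(W)$ with diagonal entries $\lambda_i=1-W_{ii}$, and let $v\in\mathbb R^{\mathcal V}$. Assume that in the graph associated to $W$, for any node $\ell\in\mathcal V$ there exists a path from $\ell$ to a node $i$ such that $W_{ii}>0$. Let $\{\theta(k)\}_{k\in\mathbb Z_{\ge0}}$ be i.i.d. and uniformly distributed over $\mathcal E$, let $x(0)=v$ and, for $k\ge0$, if $\theta(k)=(i,j)$, let $$x_i(k+1)=h_i\big((1-\Gamma_{ij})x_i(k)+\Gamma_{ij}x_j(k)\big)+(1-h_i)v_i,\qquad x_\ell(k+1)=x_\ell(k)\ \ \text{for }\ell\in\mathcal V\setminus\{i\},$$ where the coefficients $h_i$ and $\Gamma_{ij}$ are those defined in the context. Then the process $\{x(k)\}$ is almost surely ergodic and mean-square ergodic, and the time-averaged opinions $\frac1k\sum_{\ell=0}^{k-1}x(\ell)$ converge (almost surely and in mean square) to $$x^\star_{\rm opd}=(I-\Lambda W)^{-1}(I-\Lambda)v.$$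
   Context: $\mathrm{diag}(W)$ is the diagonal matrix with the same diagonal as $W$. The graph associated to $W$ has node set $\mathcal V$ and an edge $(i,j)$ if and only if $W_{ij}>0$. With $d_i=|\{h\in\mathcal V:(i,h)\in\mathcal E\}|$ (so $d_i\ge1$), define $$h_i=\begin{cases}1-(1-\lambda_i)/d_i&\text{if }d_i\ne1\\0&\text{otherwise,}\end{cases}$$ $$\Gamma_{ij}=\begin{cases}\dfrac{d_i(1-h_i)+h_i-(1-\lambda_iW_{ii})}{h_i}&\text{if }i=j,\ d_i\neq1\\[1ex]\dfrac{\lambda_iW_{ij}}{h_i}&\text{if }i\ne j,\ d_i\ne1\\1&\text{if }i=j,\ d_i=1\\0&\text{if }i\ne j,\ d_i=1.\end{cases}$$ A process $\{x(k)\}$ is (almost surely) ergodic if there is a random variable $x_\infty\in\mathbb R^{\mathcal V}$ with $\frac1k\sum_{\ell=0}^{k-1}x(\ell)\to\mathbb E[x_\infty]$ almost surely, and mean-square ergodic if $\mathbb E\big[\|\frac1k\sum_{\ell=0}^{k-1}x(\ell)-\mathbb E[x_\infty]\|_2^2\big]\to0$. *)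

theory Defs
  imports "HOL-Probability.Probability"
begin

definition row_stochastic :: "real^'n^'n \<Rightarrow> bool" where
  "row_stochastic W \<longleftrightarrow> (\<forall>i j. 0 \<le> W $ i $ j) \<and> (\<forall>i. (\<Sum>j\<in>UNIV. W $ i $ j) = 1)"

definition diag_part :: "real^'n^'n \<Rightarrow> real^'n^'n" where
  "diag_part W = (\<chi> i j. if i = j then W $ i $ j else 0)"

definition Lam :: "real^'n^'n \<Rightarrow> real^'n^'n" where
  "Lam W = mat 1 - diag_part W"

definition lam :: "real^'n^'n \<Rightarrow> 'n \<Rightarrow> real" where
  "lam W i = Lam W $ i $ i"

lemma lam_eq: "lam W i = 1 - W $ i $ i"
  by (simp add: lam_def Lam_def diag_part_def mat_def)

definition assoc_graph :: "real^'n^'n \<Rightarrow> ('n \<times> 'n) set" where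
  "assoc_graph W = {(i, j). W $ i $ j > 0}"

definition out_degree :: "('n::finite \<times> 'n) set \<Rightarrow> 'n \<Rightarrow> nat" where
  "out_degree E i = card {j. (i, j) \<in> E}"

definition h_coeff :: "('n::finite \<times> 'n) set \<Rightarrow> real^'n^'n \<Rightarrow> 'n \<Rightarrow> real" where
  "h_coeff E W i =
     (if out_degree E i \<noteq> 1 then 1 - (1 - lam W i) / real (out_degree E i) else 0)"

definition Gamma_coeff :: "('n::finite \<times> 'n) set \<Rightarrow> real^'n^'n \<Rightarrow> 'n \<Rightarrow> 'n \<Rightarrow> real" where
  "Gamma_coeff E W i j =
     (if out_degree E i \<noteq> 1 then
        (if i = j then
           (real (out_degree E i) * (1 - h_coeff E W i) + h_coeff E W i
              - (1 - lam W i * W $ i $ i)) / h_coeff E W i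
         else lam W i * W $ i $ j / h_coeff E W i)
      else (if i = j then 1 else 0))"

definition gossip_update ::
    "('n::finite \<times> 'n) set \<Rightarrow> real^'n^'n \<Rightarrow> real^'n \<Rightarrow> 'n \<times> 'n \<Rightarrow> real^'n \<Rightarrow> real^'n" where
  "gossip_update E W v e y = (case e of (i, j) \<Rightarrow>
     (\<chi> l. if l = i
            then h_coeff E W i * ((1 - Gamma_coeff E W i j) * y $ i + Gamma_coeff E W i j * y $ j)
                 + (1 - h_coeff E W i) * v $ i
            else y $ l))"

definition time_average :: "(nat \<Rightarrow> 'w \<Rightarrow> real^'n) \<Rightarrow> nat \<Rightarrow> 'w \<Rightarrow> real^'n" where
  "time_average x k \<omega> = (1 / real k) *\<^sub>R (\<Sum>l<k. x l \<omega>)"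

definition converges_almost_surely ::
    "'w measure \<Rightarrow> (nat \<Rightarrow> 'w \<Rightarrow> real^'n) \<Rightarrow> real^'n \<Rightarrow> bool" where
  "converges_almost_surely M Y a \<longleftrightarrow> (AE \<omega> in M. (\<lambda>k. Y k \<omega>) \<longlonglongrightarrow> a)"

text \<open>Integrability is required explicitly because the Bochner integral of a non-integrable
  function is 0.\<close>

definition converges_in_mean_square ::
    "'w measure \<Rightarrow> (nat \<Rightarrow> 'w \<Rightarrow> real^'n) \<Rightarrow> real^'n \<Rightarrow> bool" where
  "converges_in_mean_square M Y a \<longleftrightarrow>
     (\<forall>k. integrable M (\<lambda>\<omega>. (norm (Y k \<omega> - a))\<^sup>2)) \<and>
     (\<lambda>k. \<integral>\<omega>. (norm (Y k \<omega> - a))\<^sup>2 \<partial>M) \<longlonglongrightarrow> 0"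

definition almost_surely_ergodic :: "'w measure \<Rightarrow> (nat \<Rightarrow> 'w \<Rightarrow> real^'n) \<Rightarrow> bool" where
  "almost_surely_ergodic M x \<longleftrightarrow>
     (\<exists>xinf :: 'w \<Rightarrow> real^'n. integrable M xinf \<and>
        converges_almost_surely M (time_average x) (\<integral>\<omega>. xinf \<omega> \<partial>M))"

definition mean_square_ergodic :: "'w measure \<Rightarrow> (nat \<Rightarrow> 'w \<Rightarrow> real^'n) \<Rightarrow> bool" where
  "mean_square_ergodic M x \<longleftrightarrow>
     (\<exists>xinf :: 'w \<Rightarrow> real^'n. integrable M xinf \<and>
        converges_in_mean_square M (time_average x) (\<integral>\<omega>. xinf \<omega> \<partial>M))"

definition x_opd :: "real^'n^'n \<Rightarrow> real^'n \<Rightarrow> real^'n" where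
  "x_opd W v = matrix_inv (mat 1 - Lam W ** W) *v ((mat 1 - Lam W) *v v)"

end

theory Submission
  imports Defs "HOL-Library.Discrete_Functions"
begin

text \<open>The coefficients are tuned so that, given \<open>x(k) = y\<close>, the expected increment of the process is
  \<open>(b - H y) / |E|\<close> with \<open>H = I - \<Lambda> W\<close> and \<open>b = (I - \<Lambda>) v\<close>. Sum the increments up to time \<open>k\<close> and
  divide by \<open>k\<close>. The total increment disappears because the process is bounded. The centred noise
  averages out because it is bounded and orthogonal: its averages tend to 0 almost surely along the
  squares, and the gaps between squares are too short to matter. Hence \<open>H\<close> applied to the time
  average tends to \<open>b\<close>, and \<open>H\<close> is invertible by a maximum principle along the graph of \<open>W\<close>.
  Convergence in mean square follows by dominated convergence.\<close>

section \<open>Averages of bounded and orthogonal sequences\<close>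

text \<open>If \<open>n\<close> is the integer square root of \<open>k\<close>, at most
  \<open>2 * n\<close> terms lie between \<open>n\<^sup>2\<close> and \<open>k\<close>. They
  contribute at most \<open>2 * n * C\<close> to the sum, hence at most \<open>2 * C / n\<close>
  after division by \<open>k\<close>, which is at least \<open>n\<^sup>2\<close>.\<close>

lemma averages_tendsto_zero_of_squares:
  fixes \<xi> :: "nat \<Rightarrow> 'a::real_normed_vector"
  assumes bounded: "\<And>k. norm (\<xi> k) \<le> C"
    and squares: "(\<lambda>n. norm (\<Sum>l<n\<^sup>2. \<xi> l) / real (n\<^sup>2)) \<longlonglongrightarrow> 0"
  shows "(\<lambda>k. (1 / real k) *\<^sub>R (\<Sum>l<k. \<xi> l)) \<longlonglongrightarrow> 0"
proof (rule Lim_null_comparison)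
  let ?a = "\<lambda>n. norm (\<Sum>l<n\<^sup>2. \<xi> l) / real (n\<^sup>2) + 2 * C / real n"
  have "filterlim floor_sqrt at_top sequentially"
    unfolding filterlim_at_top
  proof
    fix Z
    show "\<forall>\<^sub>F n in sequentially. Z \<le> floor_sqrt n"
      using eventually_ge_at_top[of "Z\<^sup>2"] by eventually_elim (rule le_floor_sqrtI)
  qed
  moreover have "?a \<longlonglongrightarrow> 0"
    using tendsto_add[OF squares lim_const_over_n[of "2 * C"]] by simp
  ultimately show "(\<lambda>k. ?a (floor_sqrt k)) \<longlonglongrightarrow> 0"
    by (rule filterlim_compose[rotated])
  show "\<forall>\<^sub>F k in sequentially. norm ((1 / real k) *\<^sub>R (\<Sum>l<k. \<xi> l)) \<le> ?a (floor_sqrt k)"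
    using eventually_gt_at_top[of 0]
  proof eventually_elim
    fix k :: nat
    assume "0 < k"
    define n where "n = floor_sqrt k"
    have n: "0 < n" "n\<^sup>2 \<le> k" and "k < (Suc n)\<^sup>2"
      using \<open>0 < k\<close> Suc_floor_sqrt_power2_gt by (auto simp: n_def)
    then have gap: "k - n\<^sup>2 \<le> 2 * n"
      by (simp add: power2_eq_square)
    have C: "0 \<le> C"
      using bounded[of 0] norm_ge_zero order_trans by blast
    have "(\<Sum>l<k. \<xi> l) = (\<Sum>l<n\<^sup>2. \<xi> l) + (\<Sum>l=n\<^sup>2..<k. \<xi> l)"
      using n by (simp add: sum.atLeastLessThan_concat lessThan_atLeast0)
    moreover have "norm (\<Sum>l=n\<^sup>2..<k. \<xi> l) \<le> of_nat (card {n\<^sup>2..<k}) * C"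
      by (rule sum_norm_bound) (rule bounded)
    moreover have "of_nat (card {n\<^sup>2..<k}) * C \<le> real (2 * n) * C"
      using gap C by (intro mult_right_mono) (simp_all del: of_nat_mult)
    ultimately have S: "norm (\<Sum>l<k. \<xi> l) \<le> norm (\<Sum>l<n\<^sup>2. \<xi> l) + 2 * n * C"
      using norm_triangle_ineq[of "\<Sum>l<n\<^sup>2. \<xi> l" "\<Sum>l=n\<^sup>2..<k. \<xi> l"] by simp
    have "norm ((1 / real k) *\<^sub>R (\<Sum>l<k. \<xi> l)) = norm (\<Sum>l<k. \<xi> l) / k"
      by simp
    also have "\<dots> \<le> (norm (\<Sum>l<n\<^sup>2. \<xi> l) + 2 * n * C) / real (n\<^sup>2)"
      using S n C by (intro frac_le) (simp_all del: of_nat_power)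
    also have "\<dots> = ?a n"
      using n by (simp add: field_simps power2_eq_square)
    finally show "norm ((1 / real k) *\<^sub>R (\<Sum>l<k. \<xi> l)) \<le> ?a (floor_sqrt k)"
      by (simp add: n_def)
  qed
qed

text \<open>Pythagoras by induction: the cross terms with the new summand vanish in expectation, so
  each summand adds only its own second moment, at most \<open>C\<^sup>2\<close>.\<close>

lemma (in prob_space) orthogonal_second_moment:
  fixes \<xi> :: "nat \<Rightarrow> 'a \<Rightarrow> 'b::euclidean_space"
  assumes meas [measurable]: "\<And>k. \<xi> k \<in> borel_measurable M"
    and bounded: "\<And>k \<omega>. norm (\<xi> k \<omega>) \<le> C"
    and orth: "\<And>j k. j < k \<Longrightarrow> expectation (\<lambda>\<omega>. \<xi> j \<omega> \<bullet> \<xi> k \<omega>) = 0"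
  shows "expectation (\<lambda>\<omega>. (norm (\<Sum>l<n. \<xi> l \<omega>))\<^sup>2) \<le> real n * C\<^sup>2"
proof (induction n)
  case 0
  show ?case by simp
next
  case (Suc n)
  have C: "0 \<le> C"
    using bounded order_trans[OF norm_ge_zero] by blast
  have int: "integrable M (\<lambda>\<omega>. \<xi> j \<omega> \<bullet> \<xi> k \<omega>)" for j k
  proof (rule integrable_const_bound[where B = "C * C"])
    have "\<bar>\<xi> j \<omega> \<bullet> \<xi> k \<omega>\<bar> \<le> C * C" for \<omega>
      using Cauchy_Schwarz_ineq2 mult_mono[OF bounded[of j \<omega>] bounded[of k \<omega>] C norm_ge_zero]
      by (rule order_trans)
    then show "AE \<omega> in M. norm (\<xi> j \<omega> \<bullet> \<xi> k \<omega>) \<le> C * C"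
      by simp
  qed simp
  have split: "(norm (\<Sum>l<Suc n. \<xi> l \<omega>))\<^sup>2
      = (norm (\<Sum>l<n. \<xi> l \<omega>))\<^sup>2 + 2 * (\<Sum>l<n. \<xi> l \<omega> \<bullet> \<xi> n \<omega>) + \<xi> n \<omega> \<bullet> \<xi> n \<omega>" for \<omega>
    unfolding inner_sum_left[symmetric]
    by (simp add: power2_norm_eq_inner inner_add_left inner_add_right inner_commute)
  have intS: "integrable M (\<lambda>\<omega>. (norm (\<Sum>l<n. \<xi> l \<omega>))\<^sup>2)"
    unfolding power2_norm_eq_inner inner_sum_left inner_sum_right
    by (intro Bochner_Integration.integrable_sum int)
  have "expectation (\<lambda>\<omega>. (norm (\<Sum>l<Suc n. \<xi> l \<omega>))\<^sup>2)
      = expectation (\<lambda>\<omega>. (norm (\<Sum>l<n. \<xi> l \<omega>))\<^sup>2) + expectation (\<lambda>\<omega>. \<xi> n \<omega> \<bullet> \<xi> n \<omega>)"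
    unfolding split using int intS orth by simp
  also have "expectation (\<lambda>\<omega>. \<xi> n \<omega> \<bullet> \<xi> n \<omega>) \<le> expectation (\<lambda>\<omega>. C\<^sup>2)"
  proof (rule integral_mono[OF int])
    show "\<xi> n \<omega> \<bullet> \<xi> n \<omega> \<le> C\<^sup>2" for \<omega>
      using bounded[of n \<omega>] by (simp add: power2_norm_eq_inner[symmetric] power_mono)
  qed simp
  finally show ?case
    using Suc prob_space by (simp add: algebra_simps)
qed

text \<open>The average over \<open>n\<^sup>2\<close> terms has second moment at most
  \<open>C\<^sup>2 / n\<^sup>2\<close>, which is summable in \<open>n\<close>. So the sum of its
  squared norms is almost surely finite and the terms tend to 0 along the squares; boundedness fills
  the gaps.\<close>

lemma (in prob_space) orthogonal_averages_AE:
  fixes \<xi> :: "nat \<Rightarrow> 'a \<Rightarrow> 'b::euclidean_space"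
  assumes meas [measurable]: "\<And>k. \<xi> k \<in> borel_measurable M"
    and bounded: "\<And>k \<omega>. norm (\<xi> k \<omega>) \<le> C"
    and orth: "\<And>j k. j < k \<Longrightarrow> expectation (\<lambda>\<omega>. \<xi> j \<omega> \<bullet> \<xi> k \<omega>) = 0"
  shows "AE \<omega> in M. (\<lambda>k. (1 / real k) *\<^sub>R (\<Sum>l<k. \<xi> l \<omega>)) \<longlonglongrightarrow> 0"
proof -
  let ?f = "\<lambda>n \<omega>. (norm (\<Sum>l<n\<^sup>2. \<xi> l \<omega>) / real (n\<^sup>2))\<^sup>2"
  have int: "integrable M (\<lambda>\<omega>. (norm (\<Sum>l<m. \<xi> l \<omega>))\<^sup>2)" for m
  proof (rule integrable_const_bound[where B = "(real m * C)\<^sup>2"])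
    have "norm (\<Sum>l<m. \<xi> l \<omega>) \<le> real m * C" for \<omega>
      using sum_norm_bound[of "{..<m}" "\<lambda>l. \<xi> l \<omega>" C] bounded by simp
    then show "AE \<omega> in M. norm ((norm (\<Sum>l<m. \<xi> l \<omega>))\<^sup>2) \<le> (real m * C)\<^sup>2"
      by (intro AE_I2) (simp add: power_mono)
  qed simp
  \<comment> \<open>This includes \<open>n = 0\<close>, where both sides are 0 because division by
    zero and \<open>inverse 0\<close> are 0.\<close>
  have "(\<integral>\<^sup>+\<omega>. ennreal (?f n \<omega>) \<partial>M) \<le> ennreal (C\<^sup>2 * inverse (real n ^ 2))" for n
  proof -
    have "(\<integral>\<^sup>+\<omega>. ennreal (?f n \<omega>) \<partial>M) = ennreal (expectation (?f n))"
      using int by (intro nn_integral_eq_integral) (auto simp: power_divide)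
    also have "expectation (?f n) = expectation (\<lambda>\<omega>. (norm (\<Sum>l<n\<^sup>2. \<xi> l \<omega>))\<^sup>2) / (real n ^ 2)\<^sup>2"
      by (simp add: power_divide)
    also have "\<dots> \<le> (real (n\<^sup>2) * C\<^sup>2) / (real n ^ 2)\<^sup>2"
      by (intro divide_right_mono orthogonal_second_moment assms) auto
    also have "\<dots> = C\<^sup>2 * inverse (real n ^ 2)"
      by (simp add: field_simps power2_eq_square)
    finally show ?thesis by (simp add: ennreal_leI)
  qed
  then have "(\<Sum>n. \<integral>\<^sup>+\<omega>. ennreal (?f n \<omega>) \<partial>M) \<le> (\<Sum>n. ennreal (C\<^sup>2 * inverse (real n ^ 2)))"
    by (intro suminf_le) auto
  also have "\<dots> < \<infinity>"
    using summable_mult[OF inverse_power_summable[of 2, where 'a=real], of "C\<^sup>2"]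
    by (subst suminf_ennreal2) auto
  finally have "(\<integral>\<^sup>+\<omega>. (\<Sum>n. ennreal (?f n \<omega>)) \<partial>M) \<noteq> \<infinity>"
    by (subst nn_integral_suminf) auto
  then have "AE \<omega> in M. (\<Sum>n. ennreal (?f n \<omega>)) \<noteq> \<infinity>"
    by (intro nn_integral_PInf_AE) auto
  then show ?thesis
  proof eventually_elim
    fix \<omega>
    assume "(\<Sum>n. ennreal (?f n \<omega>)) \<noteq> \<infinity>"
    then have "summable (\<lambda>n. ?f n \<omega>)"
      by (intro summable_suminf_not_top) auto
    then have "(\<lambda>n. ?f n \<omega>) \<longlonglongrightarrow> 0"
      by (rule summable_LIMSEQ_zero)
    then have "(\<lambda>n. norm (\<Sum>l<n\<^sup>2. \<xi> l \<omega>) / real (n\<^sup>2)) \<longlonglongrightarrow> 0"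
      using tendsto_real_sqrt by fastforce
    then show "(\<lambda>k. (1 / real k) *\<^sub>R (\<Sum>l<k. \<xi> l \<omega>)) \<longlonglongrightarrow> 0"
      by (rule averages_tendsto_zero_of_squares[OF bounded])
  qed
qed

section \<open>Functions of finitely many samples from a finite type\<close>

text \<open>The first \<open>k\<close> samples live in a finite product of finite discrete spaces,
  which is itself discrete, so every function of them is measurable.\<close>

lemma (in prob_space) finite_history_measurable:
  fixes \<theta> :: "nat \<Rightarrow> 'a \<Rightarrow> 's::finite" and g :: "(nat \<Rightarrow> 's) \<Rightarrow> 'b::topological_space"
  assumes meas: "\<And>i. \<theta> i \<in> measurable M (count_space UNIV)"
    and hist: "\<And>s. g s = g (restrict s {..<k})"
  shows "(\<lambda>\<omega>. g (\<lambda>i. \<theta> i \<omega>)) \<in> borel_measurable M"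
proof -
  have "(\<lambda>\<omega>. restrict (\<lambda>i. \<theta> i \<omega>) {..<k}) \<in> measurable M (PiM {..<k} (\<lambda>_. count_space UNIV))"
    by (intro measurable_restrict meas)
  moreover have "g \<in> borel_measurable (PiM {..<k} (\<lambda>_. count_space (UNIV :: 's set)))"
    by (subst count_space_PiM_finite) auto
  ultimately have "(\<lambda>\<omega>. g (restrict (\<lambda>i. \<theta> i \<omega>) {..<k})) \<in> borel_measurable M"
    by (rule measurable_compose)
  then show ?thesis
    by (subst hist)
qed

lemma (in prob_space) finite_history_integrable:
  fixes \<theta> :: "nat \<Rightarrow> 'a \<Rightarrow> 's::finite" and g :: "(nat \<Rightarrow> 's) \<Rightarrow> real"
  assumes meas: "\<And>i. \<theta> i \<in> measurable M (count_space UNIV)"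
    and hist: "\<And>s. g s = g (restrict s {..<k})"
  shows "integrable M (\<lambda>\<omega>. g (\<lambda>i. \<theta> i \<omega>))"
proof (rule integrable_const_bound)
  let ?P = "PiE {..<k} (\<lambda>_. UNIV :: 's set)"
  have "finite ?P"
    by (intro finite_PiE) auto
  then have "norm (g s) \<le> Max ((\<lambda>s. norm (g s)) ` ?P)" for s
    by (subst hist) (intro Max_ge, auto)
  then show "AE \<omega> in M. norm (g (\<lambda>i. \<theta> i \<omega>)) \<le> Max ((\<lambda>s. norm (g s)) ` ?P)"
    by simp
  show "(\<lambda>\<omega>. g (\<lambda>i. \<theta> i \<omega>)) \<in> borel_measurable M"
    by (rule finite_history_measurable) (rule meas, rule hist)
qed

text \<open>This stands in for conditioning on the past. Splitting over the value \<open>e\<close>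
  of sample \<open>k\<close> makes each term a product of a function of the past and an indicator of
  the fresh sample. These are independent, so the expectation factors, and the recombined sum is
  zero pointwise by \<open>centred\<close>.\<close>

lemma (in prob_space) expectation_fresh_sample_eq_0:
  fixes \<theta> :: "nat \<Rightarrow> 'a \<Rightarrow> 's::finite" and g :: "(nat \<Rightarrow> 's) \<Rightarrow> 's \<Rightarrow> real"
  assumes indep: "indep_vars (\<lambda>_. count_space UNIV) \<theta> UNIV"
    and hist: "\<And>s e. g s e = g (restrict s {..<k}) e"
    and centred: "\<And>s. (\<Sum>e\<in>UNIV. g s e * prob {\<omega>\<in>space M. \<theta> k \<omega> = e}) = 0"
  shows "expectation (\<lambda>\<omega>. g (\<lambda>i. \<theta> i \<omega>) (\<theta> k \<omega>)) = 0"
proof -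
  have meas [measurable]: "\<theta> i \<in> measurable M (count_space UNIV)" for i
    using indep by (simp add: indep_vars_def)
  let ?N = "\<lambda>I. PiM I (\<lambda>_. count_space (UNIV :: 's set))"
  let ?past = "\<lambda>\<omega>. restrict (\<lambda>i. \<theta> i \<omega>) {..<k}"
  have int: "integrable M (\<lambda>\<omega>. g (\<lambda>i. \<theta> i \<omega>) e)" for e
    by (rule finite_history_integrable[where g = "\<lambda>s. g s e"]) (rule meas, rule hist)
  have int1: "integrable M (\<lambda>\<omega>. indicator {e} (\<theta> k \<omega>) :: real)" for e
    by (rule integrable_const_bound[where B = 1]) (auto simp: indicator_def)
  \<comment> \<open>The two variables read the disjoint index blocks \<open>{..<k}\<close> and
    \<open>{k}\<close>.\<close>
  have iv: "indep_var borel (\<lambda>\<omega>. g (\<lambda>i. \<theta> i \<omega>) e) borel (\<lambda>\<omega>. indicator {e} (\<theta> k \<omega>) :: real)" for e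
  proof -
    have "indep_var (?N {..<k}) ?past (?N {k}) (\<lambda>\<omega>. restrict (\<lambda>i. \<theta> i \<omega>) {k})"
      by (rule indep_var_restrict[OF indep]) auto
    then have "indep_var borel ((\<lambda>s. g s e) \<circ> ?past)
        borel ((\<lambda>s. indicator {e} (s k) :: real) \<circ> (\<lambda>\<omega>. restrict (\<lambda>i. \<theta> i \<omega>) {k}))"
      by (rule indep_var_compose) (subst count_space_PiM_finite, auto)+
    moreover have "(\<lambda>s. g s e) \<circ> ?past = (\<lambda>\<omega>. g (\<lambda>i. \<theta> i \<omega>) e)"
      using hist by (auto simp: fun_eq_iff)
    ultimately show ?thesis
      by (simp add: comp_def)
  qed
  have prod: "integrable M (\<lambda>\<omega>. g (\<lambda>i. \<theta> i \<omega>) e * indicator {e} (\<theta> k \<omega>))" for e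
    by (rule indep_var_integrable[OF iv int int1])
  have expand: "g s (s k) = (\<Sum>e\<in>UNIV. g s e * indicator {e} (s k))" for s
    by (simp add: indicator_def if_distrib cong: if_cong)
  have "expectation (\<lambda>\<omega>. g (\<lambda>i. \<theta> i \<omega>) (\<theta> k \<omega>))
      = expectation (\<lambda>\<omega>. \<Sum>e\<in>UNIV. g (\<lambda>i. \<theta> i \<omega>) e * indicator {e} (\<theta> k \<omega>))"
    by (subst expand) (rule refl)
  also have "\<dots> = (\<Sum>e\<in>UNIV. expectation (\<lambda>\<omega>. g (\<lambda>i. \<theta> i \<omega>) e * indicator {e} (\<theta> k \<omega>)))"
    by (rule Bochner_Integration.integral_sum) (rule prod)
  also have "\<dots> = (\<Sum>e\<in>UNIV. expectation (\<lambda>\<omega>. g (\<lambda>i. \<theta> i \<omega>) e) * prob {\<omega>\<in>space M. \<theta> k \<omega> = e})"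
  proof (rule sum.cong[OF refl])
    fix e
    have "expectation (\<lambda>\<omega>. indicator {e} (\<theta> k \<omega>) :: real) = expectation (indicator {\<omega>\<in>space M. \<theta> k \<omega> = e})"
      by (rule Bochner_Integration.integral_cong) (auto simp: indicator_def)
    then show "expectation (\<lambda>\<omega>. g (\<lambda>i. \<theta> i \<omega>) e * indicator {e} (\<theta> k \<omega>))
        = expectation (\<lambda>\<omega>. g (\<lambda>i. \<theta> i \<omega>) e) * prob {\<omega>\<in>space M. \<theta> k \<omega> = e}"
      by (subst indep_var_lebesgue_integral[OF iv int int1]) simp
  qed
  also have "\<dots> = expectation (\<lambda>\<omega>. \<Sum>e\<in>UNIV. g (\<lambda>i. \<theta> i \<omega>) e * prob {\<omega>\<in>space M. \<theta> k \<omega> = e})"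
    using int by simp
  also have "\<dots> = 0"
    by (simp add: centred)
  finally show ?thesis .
qed

text \<open>The process as a deterministic function of the whole sample sequence. State
  \<open>k\<close> reads only the samples before \<open>k\<close>, so it is a finite-history
  function in the sense of the preceding lemmas.\<close>

primrec trajectory :: "('s \<Rightarrow> 'b \<Rightarrow> 'b) \<Rightarrow> 'b \<Rightarrow> (nat \<Rightarrow> 's) \<Rightarrow> nat \<Rightarrow> 'b" where
  "trajectory f y s 0 = y"
| "trajectory f y s (Suc k) = f (s k) (trajectory f y s k)"

lemma trajectory_cong:
  "(\<And>i. i < k \<Longrightarrow> s i = t i) \<Longrightarrow> trajectory f y s k = trajectory f y t k"
  by (induction k) auto

lemma trajectory_restrict:
  "k \<le> m \<Longrightarrow> trajectory f y (restrict s {..<m}) k = trajectory f y s k"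
  by (rule trajectory_cong) auto

text \<open>For \<open>j < k\<close> both the noise at time \<open>j\<close> and the state at time
  \<open>k\<close> are determined by the samples before \<open>k\<close>. With these frozen, the
  inner product is linear in the fresh noise, whose mean is zero in every state; hence the noise is
  orthogonal.\<close>

lemma (in prob_space) trajectory_noise_averages_AE:
  fixes \<theta> :: "nat \<Rightarrow> 'a \<Rightarrow> 's::finite" and G :: "'s \<Rightarrow> 'b \<Rightarrow> 'b::euclidean_space"
  assumes indep: "indep_vars (\<lambda>_. count_space UNIV) \<theta> UNIV"
    and law: "\<And>k e. prob {\<omega>\<in>space M. \<theta> k \<omega> = e} = p e"
    and centred: "\<And>y. (\<Sum>e\<in>UNIV. p e *\<^sub>R G e y) = 0"
    and bounded: "\<And>s k. norm (G (s k) (trajectory f y s k)) \<le> C"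
  shows "AE \<omega> in M. (\<lambda>k. (1 / real k) *\<^sub>R
           (\<Sum>l<k. G (\<theta> l \<omega>) (trajectory f y (\<lambda>i. \<theta> i \<omega>) l))) \<longlonglongrightarrow> 0"
proof (rule orthogonal_averages_AE)
  have meas: "\<theta> i \<in> measurable M (count_space UNIV)" for i
    using indep by (simp add: indep_vars_def)
  show "(\<lambda>\<omega>. G (\<theta> l \<omega>) (trajectory f y (\<lambda>i. \<theta> i \<omega>) l)) \<in> borel_measurable M" for l
    \<comment> \<open>The history has length \<open>Suc l\<close>, since the noise at time
      \<open>l\<close> also reads sample \<open>l\<close>.\<close>
    by (rule finite_history_measurable[OF meas, where k = "Suc l"
          and g = "\<lambda>s. G (s l) (trajectory f y s l)"])
      (simp add: trajectory_restrict)
  show "norm (G (\<theta> l \<omega>) (trajectory f y (\<lambda>i. \<theta> i \<omega>) l)) \<le> C" for l \<omega>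
    using bounded[of "\<lambda>i. \<theta> i \<omega>" l] .
  show "expectation (\<lambda>\<omega>. G (\<theta> j \<omega>) (trajectory f y (\<lambda>i. \<theta> i \<omega>) j)
          \<bullet> G (\<theta> k \<omega>) (trajectory f y (\<lambda>i. \<theta> i \<omega>) k)) = 0" if "j < k" for j k
  proof (rule expectation_fresh_sample_eq_0[OF indep, where k = k
        and g = "\<lambda>s e. G (s j) (trajectory f y s j) \<bullet> G e (trajectory f y s k)"])
    show "G (s j) (trajectory f y s j) \<bullet> G e (trajectory f y s k)
        = G (restrict s {..<k} j) (trajectory f y (restrict s {..<k}) j)
            \<bullet> G e (trajectory f y (restrict s {..<k}) k)" for s e
      using that by (simp add: trajectory_restrict)
    show "(\<Sum>e\<in>UNIV. G (s j) (trajectory f y s j) \<bullet> G e (trajectory f y s k)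
            * prob {\<omega>\<in>space M. \<theta> k \<omega> = e}) = 0" for s
      using arg_cong[OF centred[of "trajectory f y s k"], of "inner (G (s j) (trajectory f y s j))"]
      by (simp add: law inner_sum_right mult.commute)
  qed
qed

section \<open>The matrix \<open>mat 1 - Lam W ** W\<close> and its invertibility\<close>

lemma matrix_inv_left: "invertible A \<Longrightarrow> matrix_inv A ** A = mat 1"
  unfolding invertible_def matrix_inv_def by (rule someI2_ex) auto

lemma Lam_matrix_vector_component:
  "((mat 1 - Lam W ** W) *v y) $ i = y $ i - lam W i * (\<Sum>j\<in>UNIV. W $ i $ j * y $ j)"
proof -
  have "Lam W = (\<chi> i j. if i = j then lam W i else 0)"
    by (simp add: vec_eq_iff lam_eq) (simp add: Lam_def diag_part_def mat_def)
  then have "(Lam W *v z) $ i = lam W i * z $ i" for z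
    by (simp add: matrix_vector_mult_def if_distrib if_distribR cong: if_cong)
  then show ?thesis
    by (simp add: matrix_vector_mult_diff_rdistrib matrix_vector_mul_assoc[symmetric])
      (simp add: matrix_vector_mult_def)
qed

lemma bias_component: "((mat 1 - Lam W) *v v) $ i = (1 - lam W i) * v $ i"
proof -
  have "mat 1 - Lam W = (\<chi> i j. if i = j then 1 - lam W i else 0)"
    by (simp add: vec_eq_iff lam_eq) (simp add: Lam_def diag_part_def mat_def)
  then show ?thesis
    by (simp add: matrix_vector_mult_def if_distrib if_distribR cong: if_cong)
qed

lemma row_stochastic_le_1: "row_stochastic W \<Longrightarrow> W $ i $ j \<le> 1"
  unfolding row_stochastic_def by (metis UNIV_I finite_class.finite_UNIV member_le_sum)

lemma row_stochastic_offdiag_le: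
  assumes "row_stochastic W" and "i \<noteq> j"
  shows "W $ i $ j \<le> lam W i"
proof -
  have "sum (($) (W $ i)) {i, j} \<le> sum (($) (W $ i)) UNIV"
    using assms by (intro sum_mono2) (auto simp: row_stochastic_def)
  then show ?thesis
    using assms by (simp add: row_stochastic_def lam_eq)
qed

lemma lam_bounds: "row_stochastic W \<Longrightarrow> 0 \<le> lam W i \<and> lam W i \<le> 1"
  using row_stochastic_le_1[of W i i] by (simp add: lam_eq row_stochastic_def)

text \<open>A kernel vector attains its largest modulus on a set of nodes that is closed under the edges
  of the graph of \<open>W\<close> and on which \<open>W\<close> has zero diagonal.\<close>

lemma invertible_mat_1_minus_Lam_W:
  fixes W :: "real^'n^'n"
  assumes stochastic: "row_stochastic W"
    and reach: "\<And>l. \<exists>i. (l, i) \<in> (assoc_graph W)\<^sup>* \<and> W $ i $ i > 0"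
  shows "invertible (mat 1 - Lam W ** W)"
proof -
  have "y = 0" if ker: "(mat 1 - Lam W ** W) *v y = 0" for y
  proof (rule ccontr)
    assume "y \<noteq> 0"
    define m where "m = Max (range (\<lambda>i. \<bar>y $ i\<bar>))"
    have le: "\<bar>y $ i\<bar> \<le> m" for i
      by (simp add: m_def)
    have "m \<in> range (\<lambda>i. \<bar>y $ i\<bar>)"
      unfolding m_def by (rule Max_in) auto
    then obtain a where a: "\<bar>y $ a\<bar> = m"
      by auto
    have m: "0 < m"
      using \<open>y \<noteq> 0\<close> le by (metis abs_le_zero_iff not_le order_less_le vec_eq_iff zero_index
            abs_ge_zero order_trans)
    have W: "0 \<le> W $ i $ j" "(\<Sum>j\<in>UNIV. W $ i $ j) = 1" for i j
      using stochastic by (auto simp: row_stochastic_def)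
    have fixed: "y $ i = lam W i * (\<Sum>j\<in>UNIV. W $ i $ j * y $ j)" for i
      using arg_cong[OF ker, of "\<lambda>z. z $ i"] by (simp add: Lam_matrix_vector_component)
    \<comment> \<open>At a node of maximal modulus, \<open>m <= lam W i * ?s <= lam W i * m\<close>
      with \<open>lam W i <= 1\<close> and \<open>m > 0\<close>. This forces
      \<open>lam W i = 1\<close> and \<open>?s = m\<close>, so the nonnegative gaps
      \<open>m - \<bar>y $ j\<bar>\<close> have weighted sum zero and vanish wherever the weight is
      positive.\<close>
    have tight: "W $ i $ i = 0 \<and> (\<forall>j. 0 < W $ i $ j \<longrightarrow> \<bar>y $ j\<bar> = m)" if i: "\<bar>y $ i\<bar> = m" for i
    proof -
      let ?s = "\<Sum>j\<in>UNIV. W $ i $ j * \<bar>y $ j\<bar>"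
      have "\<bar>\<Sum>j\<in>UNIV. W $ i $ j * y $ j\<bar> \<le> (\<Sum>j\<in>UNIV. \<bar>W $ i $ j * y $ j\<bar>)"
        by (rule sum_abs)
      also have "\<dots> = ?s"
        using W by (simp add: abs_mult)
      finally have "lam W i * \<bar>\<Sum>j\<in>UNIV. W $ i $ j * y $ j\<bar> \<le> lam W i * ?s"
        using lam_bounds[OF stochastic, of i] by (intro mult_left_mono) auto
      then have ms: "m \<le> lam W i * ?s"
        using arg_cong[OF fixed[of i], of abs] lam_bounds[OF stochastic, of i]
        by (simp only: abs_mult abs_of_nonneg i)
      have "?s \<le> (\<Sum>j\<in>UNIV. W $ i $ j * m)"
        using W le by (intro sum_mono mult_left_mono) auto
      then have s: "?s \<le> m"
        using W by (simp add: sum_distrib_right[symmetric])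
      have "lam W i * ?s \<le> lam W i * m"
        using lam_bounds[OF stochastic, of i] s by (intro mult_left_mono) auto
      with ms have "m \<le> lam W i * m"
        by (rule order_trans)
      then have lam: "lam W i = 1"
        using m lam_bounds[OF stochastic, of i] by simp
      have "(\<Sum>j\<in>UNIV. W $ i $ j * (m - \<bar>y $ j\<bar>)) = m - ?s"
        using W by (simp add: right_diff_distrib sum_subtractf sum_distrib_right[symmetric])
      also have "\<dots> = 0"
        using s ms lam by simp
      finally have "\<forall>j. W $ i $ j * (m - \<bar>y $ j\<bar>) = 0"
        using W le by (subst (asm) sum_nonneg_eq_0_iff) auto
      then show ?thesis
        using lam by (auto simp: lam_eq) (metis order_less_irrefl)
    qed
    obtain b where b: "(a, b) \<in> (assoc_graph W)\<^sup>*" "W $ b $ b > 0"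
      using reach by blast
    \<comment> \<open>Maximality spreads from \<open>a\<close> along each edge of the path, up to a
      node whose positive diagonal entry contradicts \<open>tight\<close>.\<close>
    from b(1) have "\<bar>y $ b\<bar> = m"
      by induction (use a tight in \<open>auto simp: assoc_graph_def\<close>)
    then have "W $ b $ b = 0"
      using tight by blast
    with b(2) show False
      by simp
  qed
  then show ?thesis
    unfolding invertible_left_inverse matrix_left_invertible_ker by blast
qed

section \<open>The gossip update: coefficients, boundedness and mean increment\<close>

text \<open>The self-loop is the only edge leaving \<open>i\<close>, so the whole row sum 1 sits on
  the diagonal entry.\<close>

lemma out_degree_1_diag:
  assumes "(i, i) \<in> E" and "row_stochastic W" and "\<And>i j. (i, j) \<notin> E \<Longrightarrow> W $ i $ j = 0"
    and "out_degree E i = 1"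
  shows "{j. (i, j) \<in> E} = {i}" and "lam W i = 0"
proof -
  obtain z where "{j. (i, j) \<in> E} = {z}"
    using assms(4) unfolding out_degree_def by (rule card_1_singletonE)
  with assms(1) show nbrs: "{j. (i, j) \<in> E} = {i}"
    by (metis mem_Collect_eq singletonD)
  have "(\<Sum>j\<in>UNIV. W $ i $ j) = (\<Sum>j\<in>{i}. W $ i $ j)"
    using assms(3) nbrs by (intro sum.mono_neutral_right) auto
  then show "lam W i = 0"
    using assms(2) by (simp add: row_stochastic_def lam_eq)
qed

text \<open>With degree at least 2, \<open>h_coeff E W i\<close> is at least
  \<open>(1 + lam W i) / 2\<close>. Positivity lets it cancel the denominators in
  \<open>Gamma_coeff\<close>; dominating \<open>lam W i\<close> keeps the weights of the update
  nonnegative.\<close>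

lemma h_coeff_pos:
  assumes "row_stochastic W" and "(i, i) \<in> E" and "out_degree E i \<noteq> 1"
  shows "out_degree E i \<ge> 2" and "lam W i \<le> h_coeff E W i" and "h_coeff E W i \<le> 1"
    and "0 < h_coeff E W i"
proof -
  have "out_degree E i \<noteq> 0"
    using assms(2) by (auto simp: out_degree_def)
  then show d: "out_degree E i \<ge> 2"
    using assms(3) by simp
  define q where "q = (1 - lam W i) / real (out_degree E i)"
  have "q \<le> (1 - lam W i) / 2"
    unfolding q_def
    using d lam_bounds[OF assms(1), of i] by (intro divide_left_mono) auto
  moreover have "h_coeff E W i = 1 - q"
    using assms(3) by (simp add: h_coeff_def q_def)
  ultimately show "lam W i \<le> h_coeff E W i" "0 < h_coeff E W i"
    using lam_bounds[OF assms(1), of i] by auto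
  show "h_coeff E W i \<le> 1"
    using assms(3) lam_bounds[OF assms(1), of i] by (auto simp: h_coeff_def)
qed

text \<open>This form separates a pull towards \<open>v $ i\<close>, the same for every neighbour
  \<open>j\<close>, from an interaction weighted by \<open>W $ i $ j\<close>. Summation over the
  neighbours then yields the drift.\<close>

lemma gossip_update_component:
  assumes "row_stochastic W" and "(i, i) \<in> E" and "out_degree E i \<noteq> 1"
  shows "gossip_update E W v (i, j) y $ i
      = y $ i + (h_coeff E W i - 1) * (y $ i - v $ i) + lam W i * W $ i $ j * (y $ j - y $ i)"
  using h_coeff_pos[OF assms] assms(3)
  by (cases "i = j") (simp_all add: gossip_update_def Gamma_coeff_def field_simps)

text \<open>The updated coordinate is \<open>v $ i\<close> in degree 1, and otherwise a convex
  combination of \<open>y $ i\<close>, \<open>y $ j\<close> and \<open>v $ i\<close> with weights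
  \<open>?h - ?c\<close>, \<open>?c\<close> and \<open>1 - ?h\<close>. Nonnegativity of the first
  weight comes from \<open>lam W i * W $ i $ j <= lam W i <= ?h\<close>.\<close>

lemma gossip_update_bounded:
  assumes "row_stochastic W" and "\<And>i. (i, i) \<in> E"
    and y: "\<And>l. \<bar>y $ l\<bar> \<le> R" and v: "\<And>l. \<bar>v $ l\<bar> \<le> R"
  shows "\<bar>gossip_update E W v e y $ l\<bar> \<le> R"
proof -
  obtain i j where e: "e = (i, j)" by (cases e)
  consider "l \<noteq> i" | "l = i" "out_degree E i = 1" | "l = i" "out_degree E i \<noteq> 1" by blast
  then show ?thesis
  proof cases
    case 1
    then show ?thesis using y by (simp add: e gossip_update_def)
  next
    case 2
    then show ?thesis using v by (simp add: e gossip_update_def h_coeff_def)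
  next
    case 3
    let ?h = "h_coeff E W i" and ?c = "if i = j then 0 else lam W i * W $ i $ j"
    note h = h_coeff_pos[OF assms(1,2) 3(2)]
    have "lam W i * W $ i $ j \<le> lam W i * 1"
      using lam_bounds[OF assms(1), of i] row_stochastic_le_1[OF assms(1)]
      by (intro mult_left_mono) auto
    then have c: "0 \<le> ?c" "?c \<le> ?h"
      using h lam_bounds[OF assms(1), of i] assms(1) by (auto simp: row_stochastic_def)
    have "gossip_update E W v e y $ l = (?h - ?c) * y $ i + ?c * y $ j + (1 - ?h) * v $ i"
      using 3 gossip_update_component[OF assms(1,2) 3(2), of v j y]
      by (cases "i = j") (simp_all add: e algebra_simps)
    moreover have "\<bar>(?h - ?c) * y $ i\<bar> \<le> (?h - ?c) * R"
      using c y by (simp only: abs_mult) (intro mult_mono, auto)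
    moreover have "\<bar>?c * y $ j\<bar> \<le> ?c * R"
      using c y by (simp only: abs_mult) (intro mult_mono, auto)
    moreover have "\<bar>(1 - ?h) * v $ i\<bar> \<le> (1 - ?h) * R"
      using h v by (simp only: abs_mult) (intro mult_mono, auto)
    moreover have "(?h - ?c) * R + ?c * R + (1 - ?h) * R = R"
      by (simp only: left_diff_distrib)
    ultimately show ?thesis
      by linarith
  qed
qed

text \<open>Coordinate \<open>i\<close> moves only on edges leaving \<open>i\<close>. Summed over
  them, the pull towards \<open>v $ i\<close> gets total weight \<open>1 - lam W i\<close>, which is
  what \<open>h_coeff\<close> is designed for, and the interaction gives \<open>lam W i\<close>
  times the difference between the \<open>W\<close>-average of \<open>y\<close> and
  \<open>y $ i\<close>. The coefficients of \<open>y $ i\<close> outside that average add up to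
  -1.\<close>

lemma gossip_update_drift:
  fixes E :: "('n::finite \<times> 'n) set"
  assumes st: "row_stochastic W" and loops: "\<And>i. (i, i) \<in> E"
    and adapted: "\<And>i j. (i, j) \<notin> E \<Longrightarrow> W $ i $ j = 0"
  shows "(\<Sum>e\<in>E. gossip_update E W v e y - y)
       = (mat 1 - Lam W) *v v - (mat 1 - Lam W ** W) *v y"
proof (rule vec_eq_iff[THEN iffD2], rule allI)
  fix i
  let ?N = "{j. (i, j) \<in> E}"
  let ?S = "\<Sum>j\<in>UNIV. W $ i $ j * y $ j"
  have "(\<Sum>e\<in>E. gossip_update E W v e y - y) $ i
      = (\<Sum>e\<in>Pair i ` ?N. gossip_update E W v e y $ i - y $ i)"
    unfolding sum_component vector_minus_component
    by (rule sum.mono_neutral_right) (auto simp: gossip_update_def)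
  also have "\<dots> = (\<Sum>j\<in>?N. gossip_update E W v (i, j) y $ i - y $ i)"
    by (subst sum.reindex) (auto simp: inj_on_def)
  also have "\<dots> = (1 - lam W i) * v $ i - (y $ i - lam W i * ?S)"
  proof (cases "out_degree E i = 1")
    case True
    \<comment> \<open>Here \<open>h_coeff\<close> and \<open>lam\<close> are both 0 and the only
      edge is the loop, so both sides equal \<open>v $ i - y $ i\<close>.\<close>
    then show ?thesis
      using out_degree_1_diag[of i E W] loops st adapted
      by (simp add: gossip_update_def h_coeff_def)
  next
    case False
    have sumW: "(\<Sum>j\<in>?N. W $ i $ j * (y $ j - y $ i)) = ?S - y $ i"
    proof -
      have "(\<Sum>j\<in>?N. W $ i $ j * (y $ j - y $ i)) = (\<Sum>j\<in>UNIV. W $ i $ j * (y $ j - y $ i))"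
        using adapted by (intro sum.mono_neutral_left) auto
      also have "\<dots> = ?S - y $ i"
        using st by (simp add: right_diff_distrib sum_subtractf row_stochastic_def
            sum_distrib_right[symmetric])
      finally show ?thesis .
    qed
    have deg: "real (card ?N) * (h_coeff E W i - 1) = - (1 - lam W i)"
      using False h_coeff_pos(1)[OF st loops False]
      by (simp add: h_coeff_def out_degree_def[symmetric] field_simps)
    have "(\<Sum>j\<in>?N. gossip_update E W v (i, j) y $ i - y $ i)
        = real (card ?N) * (h_coeff E W i - 1) * (y $ i - v $ i)
          + lam W i * (\<Sum>j\<in>?N. W $ i $ j * (y $ j - y $ i))"
      by (simp add: gossip_update_component[OF st loops False] sum.distrib sum_distrib_left mult.assoc)
    also have "\<dots> = - (1 - lam W i) * (y $ i - v $ i) + lam W i * (?S - y $ i)"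
      by (simp only: deg sumW)
    also have "\<dots> = (1 - lam W i) * v $ i - (y $ i - lam W i * ?S)"
      by (simp add: algebra_simps)
    finally show ?thesis .
  qed
  finally show "(\<Sum>e\<in>E. gossip_update E W v e y - y) $ i
      = ((mat 1 - Lam W) *v v - (mat 1 - Lam W ** W) *v y) $ i"
    by (simp add: bias_component Lam_matrix_vector_component)
qed

section \<open>Convergence of the time averages of the gossip process\<close>

theorem theorem4:
  fixes E :: "('n::finite \<times> 'n) set"
    and W :: "real^'n^'n"
    and v :: "real^'n"
    and M :: "'w measure"
    and \<theta> :: "nat \<Rightarrow> 'w \<Rightarrow> 'n \<times> 'n"
    and x :: "nat \<Rightarrow> 'w \<Rightarrow> real^'n"
  assumes more_than_two_nodes: "CARD('n) > 2"
    and self_loops: "\<And>i. (i, i) \<in> E"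
    and stochastic: "row_stochastic W"
    and adapted: "\<And>i j. (i, j) \<notin> E \<Longrightarrow> W $ i $ j = 0"
    and reach: "\<And>l. \<exists>i. (l, i) \<in> (assoc_graph W)\<^sup>* \<and> W $ i $ i > 0"
    and prob: "prob_space M"
    and indep: "prob_space.indep_vars M (\<lambda>_. count_space UNIV) \<theta> UNIV"
    and uniform: "\<And>k. distr M (count_space UNIV) (\<theta> k) = measure_pmf (pmf_of_set E)"
    and init: "\<And>\<omega>. \<omega> \<in> space M \<Longrightarrow> x 0 \<omega> = v"
    and step: "\<And>k \<omega>. \<omega> \<in> space M \<Longrightarrow> x (Suc k) \<omega> = gossip_update E W v (\<theta> k \<omega>) (x k \<omega>)"
  shows "almost_surely_ergodic M x \<and>
         mean_square_ergodic M x \<and>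
         invertible (mat 1 - Lam W ** W) \<and>
         converges_almost_surely M (time_average x) (x_opd W v) \<and>
         converges_in_mean_square M (time_average x) (x_opd W v)"
proof -
  interpret prob_space M by (rule prob)
  let ?H = "mat 1 - Lam W ** W" and ?b = "(mat 1 - Lam W) *v v" and ?f = "gossip_update E W v"
  let ?a = "x_opd W v"
  define y where "y = trajectory ?f v"
  define c where "c = 1 / real (card E)"
  \<comment> \<open>Every coordinate stays within \<open>norm v\<close>, and the Euclidean norm is
    at most the sum of the absolute coordinates.\<close>
  define R where "R = real CARD('n) * norm v"
  \<comment> \<open>The increment in state \<open>z\<close> minus its mean over a uniformly drawn
    edge.\<close>
  define G where "G e z = ?f e z - z - c *\<^sub>R (?b - ?H *v z)" for e z
  have E: "finite E" "E \<noteq> {}"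
    using self_loops by auto
  then have c: "0 < c"
    by (simp add: c_def card_gt_0_iff)
  have inv: "invertible ?H"
    by (rule invertible_mat_1_minus_Lam_W[OF stochastic reach])
  have meas: "\<theta> i \<in> measurable M (count_space UNIV)" for i
    using indep by (simp add: indep_vars_def)

  have x_eq: "x k \<omega> = y (\<lambda>i. \<theta> i \<omega>) k" if "\<omega> \<in> space M" for k \<omega>
    using that by (induction k) (simp_all add: y_def init step)
  have "\<bar>y s k $ l\<bar> \<le> norm v" for s k l
    unfolding y_def
    by (induction k arbitrary: l)
      (auto intro!: gossip_update_bounded stochastic self_loops component_le_norm_cart)
  then have y_bound: "norm (y s k) \<le> R" for s k
    using order_trans[OF norm_le_l1_cart sum_bounded_above[of UNIV "\<lambda>i. \<bar>y s k $ i\<bar>" "norm v"]]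
    by (simp add: R_def)

  \<comment> \<open>The samples range over all pairs of nodes; the indicator gives pairs outside
    \<open>E\<close> mass 0.\<close>
  have law: "prob {\<omega> \<in> space M. \<theta> k \<omega> = e} = indicator E e * c" for k e
  proof -
    have "prob {\<omega> \<in> space M. \<theta> k \<omega> = e} = measure (distr M (count_space UNIV) (\<theta> k)) {e}"
      using meas by (subst measure_distr) (auto intro!: arg_cong[where f = prob])
    then show ?thesis
      using E by (simp add: uniform measure_pmf_single c_def)
  qed
  have drift: "(\<Sum>e\<in>E. ?f e z - z) = ?b - ?H *v z" for z
    by (rule gossip_update_drift) (use stochastic self_loops adapted in auto)
  have centred: "(\<Sum>e\<in>UNIV. (indicator E e * c) *\<^sub>R G e z) = 0" for z
  proof -
    have "(\<Sum>e\<in>UNIV. (indicator E e * c) *\<^sub>R G e z) = (\<Sum>e\<in>E. c *\<^sub>R G e z)"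
      by (rule sum.mono_neutral_cong_right) auto
    also have "\<dots> = c *\<^sub>R (\<Sum>e\<in>E. ?f e z - z) - (\<Sum>e\<in>E. c *\<^sub>R c *\<^sub>R (?b - ?H *v z))"
      by (simp only: G_def scaleR_sum_right scaleR_diff_right[of c "?f e z - z" for e]
          sum_subtractf[of "\<lambda>e. c *\<^sub>R (?f e z - z)"])
    also have "(\<Sum>e\<in>E. c *\<^sub>R c *\<^sub>R (?b - ?H *v z)) = c *\<^sub>R (?b - ?H *v z)"
      using E by (simp add: sum_constant_scaleR c_def del: sum_constant)
    finally show ?thesis
      by (simp only: drift diff_self)
  qed
  have bl: "bounded_linear ((*v) ?H)"
    by (rule matrix_vector_mul_bounded_linear)
  define C where "C = R + R + c * (norm ?b + onorm ((*v) ?H) * R)"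
  have G_bound: "norm (G (s k) (y s k)) \<le> C" for s k
  proof -
    have "norm (?H *v y s k) \<le> onorm ((*v) ?H) * R"
      using onorm[OF bl] mult_left_mono[OF y_bound onorm_pos_le[OF bl]]
      by (rule order_trans)
    then have "norm (?b - ?H *v y s k) \<le> norm ?b + onorm ((*v) ?H) * R"
      by (intro order_trans[OF norm_triangle_ineq4]) simp
    moreover have "norm (?f (s k) (y s k)) \<le> R"
      using y_bound[of s "Suc k"] by (simp add: y_def)
    ultimately show ?thesis
      unfolding G_def C_def using y_bound[of s k] c
      by (intro order_trans[OF norm_triangle_ineq4] add_mono) auto
  qed
  have noise: "AE \<omega> in M. (\<lambda>k. (1 / real k) *\<^sub>R (\<Sum>l<k. G (\<theta> l \<omega>) (y (\<lambda>i. \<theta> i \<omega>) l))) \<longlonglongrightarrow> 0"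
    unfolding y_def
    by (rule trajectory_noise_averages_AE[OF indep law centred G_bound[unfolded y_def]])

  have AE_conv: "AE \<omega> in M. (\<lambda>k. time_average x k \<omega>) \<longlonglongrightarrow> ?a"
    using noise AE_space
  proof eventually_elim
    case (elim \<omega>)
    let ?y = "y (\<lambda>i. \<theta> i \<omega>)"
    let ?N = "\<lambda>k. (1 / real k) *\<^sub>R (\<Sum>l<k. G (\<theta> l \<omega>) (?y l))"
    \<comment> \<open>Obtained by solving the averaged increment identity for \<open>?H\<close>
      applied to the time average. Both terms in the inner bracket tend to 0, so \<open>?r\<close>
      tends to \<open>?b\<close>.\<close>
    let ?r = "\<lambda>k. ?b + (1 / c) *\<^sub>R (?N k - (1 / real k) *\<^sub>R (?y k - v))"
    have "(\<lambda>k. (1 / real k) *\<^sub>R (?y k - v)) \<longlonglongrightarrow> 0"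
    proof (rule Lim_null_comparison)
      show "\<forall>\<^sub>F k in sequentially. norm ((1 / real k) *\<^sub>R (?y k - v)) \<le> (R + norm v) / real k"
        by (intro always_eventually allI)
          (auto intro!: divide_right_mono order_trans[OF norm_triangle_ineq4] y_bound)
    qed (rule lim_const_over_n)
    then have "?r \<longlonglongrightarrow> ?b + (1 / c) *\<^sub>R (0 - 0)"
      using elim(1) by (intro tendsto_intros)
    then have "(\<lambda>k. matrix_inv ?H *v ?r k) \<longlonglongrightarrow> matrix_inv ?H *v (?b + (1 / c) *\<^sub>R (0 - 0))"
      by (intro bounded_linear.tendsto[OF matrix_vector_mul_bounded_linear])
    then have "(\<lambda>k. matrix_inv ?H *v ?r k) \<longlonglongrightarrow> ?a"
      by (simp add: x_opd_def)
    \<comment> \<open>The index 0 must be excluded: there \<open>?r\<close> is \<open>?b\<close>,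
      while the time average is 0.\<close>
    moreover have "\<forall>\<^sub>F k in sequentially. matrix_inv ?H *v ?r k = time_average x k \<omega>"
      using eventually_gt_at_top[of 0]
    proof eventually_elim
      case (elim k)
      let ?S = "\<Sum>l<k. ?y l"
      have avg: "time_average x k \<omega> = (1 / real k) *\<^sub>R ?S"
        using \<open>\<omega> \<in> space M\<close> by (simp add: time_average_def x_eq)
      \<comment> \<open>The increments telescope, and the drift is affine in the state, so its sum
        depends only on \<open>?S\<close>.\<close>
      have "(\<Sum>l<k. G (\<theta> l \<omega>) (?y l)) = (\<Sum>l<k. ?y (Suc l) - ?y l) - (\<Sum>l<k. c *\<^sub>R (?b - ?H *v ?y l))"
        unfolding G_def y_def trajectory.simps by (rule sum_subtractf)
      also have "(\<Sum>l<k. ?y (Suc l) - ?y l) = ?y k - v"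
        by (simp only: sum_lessThan_telescope) (simp add: y_def)
      also have "(\<Sum>l<k. c *\<^sub>R (?b - ?H *v ?y l)) = c *\<^sub>R (real k *\<^sub>R ?b - ?H *v ?S)"
        by (simp only: scaleR_sum_right[symmetric] sum_subtractf sum_constant_scaleR card_lessThan
            linear_sum[OF bounded_linear.linear[OF bl]])
      finally have noise_sum: "(\<Sum>l<k. G (\<theta> l \<omega>) (?y l)) = ?y k - v - c *\<^sub>R (real k *\<^sub>R ?b - ?H *v ?S)" .
      have "b + (1 / c) *\<^sub>R ((1 / real k) *\<^sub>R (p - c *\<^sub>R (real k *\<^sub>R b - q)) - (1 / real k) *\<^sub>R p)
          = (1 / real k) *\<^sub>R q" for b p q :: "real^'n"
        using c elim by (simp add: scaleR_diff_right)
      then have "?r k = ?H *v ((1 / real k) *\<^sub>R ?S)"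
        by (simp only: noise_sum matrix_vector_mult_scaleR)
      then show ?case
        by (simp only: avg matrix_vector_mul_assoc matrix_inv_left[OF inv] matrix_vector_mul_lid)
    qed
    ultimately show ?case
      by (rule Lim_transform_eventually)
  qed

  have [measurable]: "x k \<in> borel_measurable M" for k
  proof -
    have "(\<lambda>\<omega>. y (\<lambda>i. \<theta> i \<omega>) k) \<in> borel_measurable M"
      unfolding y_def by (rule finite_history_measurable[OF meas, where k = k
            and g = "\<lambda>s. trajectory ?f v s k"]) (simp add: trajectory_restrict)
    then show ?thesis
      by (subst measurable_cong[OF x_eq])
  qed
  have avg_meas [measurable]: "time_average x k \<in> borel_measurable M" for k
    unfolding time_average_def[abs_def] by measurable
  have avg_bound: "norm ((norm (time_average x k \<omega> - ?a))\<^sup>2) \<le> (R + norm ?a)\<^sup>2"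
    if "\<omega> \<in> space M" for k \<omega>
  proof -
    have "norm (\<Sum>l<k. x l \<omega>) \<le> real k * R"
      using sum_norm_bound[of "{..<k}" "\<lambda>l. x l \<omega>" R] that y_bound by (simp add: x_eq)
    moreover have "0 \<le> R"
      by (simp add: R_def)
    ultimately have "norm (time_average x k \<omega>) \<le> R"
      by (cases "k = 0") (simp_all add: time_average_def divide_le_eq mult.commute)
    then have "norm (time_average x k \<omega> - ?a) \<le> R + norm ?a"
      by (intro order_trans[OF norm_triangle_ineq4]) simp
    then show ?thesis
      by (simp add: power_mono)
  qed
  have int: "integrable M (\<lambda>\<omega>. (norm (time_average x k \<omega> - ?a))\<^sup>2)" for k
    by (rule integrable_const_bound[where B = "(R + norm ?a)\<^sup>2"]) (use avg_bound in auto)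
  \<comment> \<open>Dominated convergence with the constant bound from \<open>avg_bound\<close>,
    integrable on a probability space.\<close>
  have "(\<lambda>k. \<integral>\<omega>. (norm (time_average x k \<omega> - ?a))\<^sup>2 \<partial>M) \<longlonglongrightarrow> (\<integral>\<omega>. 0 \<partial>M)"
  proof (rule integral_dominated_convergence)
    show "AE \<omega> in M. (\<lambda>k. (norm (time_average x k \<omega> - ?a))\<^sup>2) \<longlonglongrightarrow> 0"
      using AE_conv
    proof eventually_elim
      case (elim \<omega>)
      then have "(\<lambda>k. (norm (time_average x k \<omega> - ?a))\<^sup>2) \<longlonglongrightarrow> (norm (?a - ?a))\<^sup>2"
        by (intro tendsto_intros)
      then show ?case by simp
    qed
    show "integrable M (\<lambda>\<omega>. (R + norm ?a)\<^sup>2)"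
      by simp
  qed (use avg_bound in auto)
  then have ms: "converges_in_mean_square M (time_average x) ?a"
    using int by (simp add: converges_in_mean_square_def)
  have as: "converges_almost_surely M (time_average x) ?a"
    using AE_conv by (simp add: converges_almost_surely_def)
  \<comment> \<open>The constant random variable \<open>?a\<close> is the witness for
    \<open>xinf\<close> in both notions of ergodicity.\<close>
  have "integrable M (\<lambda>\<omega>. ?a) \<and> (\<integral>\<omega>. ?a \<partial>M) = ?a"
    by (simp add: prob_space)
  then show ?thesis
    unfolding almost_surely_ergodic_def mean_square_ergodic_def
    using inv as ms by metis
qed

end
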